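(* There is a constant $A$ such that for every sequence $(c_n)_{n\ge 0}$ in $X$ and every $f(z)=\sum_{n=0}^{\infty} a_n z^n$ in $H^1$, $$\sum_{n=0}^{\infty} |a_n c_n| \le A\, \|(c_n)\|\, \|f\|_1 .$$
   Context: $X$ denotes the space of (complex) sequences $(c_n)_{n\ge 0}$ such that $$\|(c_n)\|^2 = \sup\left\{ \frac{\sum_{k=0}^n (k+1)^2 |c_k|^2}{n+1} : n\in\mathbb{N}\right\} < \infty ,$$ and $\|(c_n)\|$ is the norm on $X$ so defined. $H^1$ is the Hardy space of holomorphic functions $f$ on the open unit disk $\mathbb{D}$ with $$\|f\|_1=\sup_{0<r<1} \frac{1}{2\pi}\int_0^{2\pi} |f(re^{i\theta})|\, d\theta<\infty .$$ This is the same as the subspace of $L^1$ of the unit circle (normalized arc length measure) of functions whose negative Fourier coefficients vanish, with its $L^1$ norm. The $a_n$ are the Taylor coefficients of $f$ at $0$. *)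

theory Defs
  imports "HOL-Complex_Analysis.Complex_Analysis"
begin

definition X_mean :: "(nat \<Rightarrow> complex) \<Rightarrow> nat \<Rightarrow> real" where
  "X_mean c n = (\<Sum>k\<le>n. (real k + 1)\<^sup>2 * (cmod (c k))\<^sup>2) / (real n + 1)"

definition X_space :: "(nat \<Rightarrow> complex) set" where
  "X_space = {c. bdd_above (range (X_mean c))}"

text \<open>The supremum below is the \<^emph>\<open>square\<close> of the norm. The real-valued supremum is
  meaningful only on \<^const>\<open>X_space\<close>, where the set is bounded above.\<close>

definition X_norm :: "(nat \<Rightarrow> complex) \<Rightarrow> real" where
  "X_norm c = sqrt (SUP n. X_mean c n)"

definition circle_mean :: "(complex \<Rightarrow> complex) \<Rightarrow> real \<Rightarrow> real" where
  "circle_mean f r =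
     1 / (2 * pi) * integral {0..2 * pi} (\<lambda>\<theta>. cmod (f (of_real r * exp (\<i> * of_real \<theta>))))"

definition Hardy1 :: "(complex \<Rightarrow> complex) set" where
  "Hardy1 = {f. f holomorphic_on ball 0 1 \<and> bdd_above (circle_mean f ` {0<..<1})}"

text \<open>As above, this is meaningful only on \<^const>\<open>Hardy1\<close>.\<close>

definition Hardy1_norm :: "(complex \<Rightarrow> complex) \<Rightarrow> real" where
  "Hardy1_norm f = (SUP r\<in>{0<..<1}. circle_mean f r)"

end

theory Submission
  imports Defs "HOL-Computational_Algebra.Fundamental_Theorem_Algebra"
begin

text \<open>
  The inequality is a boundedness statement for a Hankel form. If \<open>f = g * h\<close> with
  \<open>\<bar>g\<bar>\<^sup>2 = \<bar>h\<bar>\<^sup>2 = \<bar>f\<bar>\<close> on the unit circle, then \<open>a n = (\<Sum>k\<le>n. g k * h (n - k))\<close> in terms of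
  Taylor coefficients, so that
  \<open>\<Sum>n. \<bar>a n * c n\<bar> \<le> \<Sum>k. \<Sum>m. \<bar>g k\<bar> * \<bar>h m\<bar> * \<bar>c (k + m)\<bar>\<close>, while the \<open>l\<^sup>2\<close> norms of both
  coefficient sequences are at most the square root of the \<open>L\<^sup>1\<close> norm of \<open>f\<close>. It remains to
  see that membership of \<open>c\<close> in \<^const>\<open>X_space\<close> makes the form on the right bounded on
  \<open>l\<^sup>2\<close>, with norm at most a constant times \<^term>\<open>X_norm c\<close>. The condition on \<open>c\<close> says that
  \<open>(n + 1) * \<bar>c n\<bar>\<close> is bounded in quadratic mean, and this gives the tail estimate
  \<open>\<Sum>n\<ge>k. \<bar>c n\<bar>\<^sup>2 * sqrt (n + 1) \<le> C / sqrt (k + 1)\<close> (lemma \<open>tail_bound\<close>); a weighted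
  Cauchy--Schwarz inequality on the half \<open>k \<le> m\<close> then bounds that half of the form (\<open>half_bilinear_bound\<close>),
  and the kernel is symmetric (\<open>hankel_bound\<close>).

  The factorization is made only for polynomials, where it can be built one linear factor at a
  time from square roots and Blaschke factors (\<open>poly_balanced_factors\<close>). A general \<open>f\<close> is
  reached through the Taylor polynomials of its dilations \<open>z \<mapsto> f (r * z)\<close>: these converge
  uniformly on the unit circle. Finite sums of \<open>\<bar>a n * c n\<bar> * r ^ n\<close> are then bounded by a constant times
  the circle mean of \<open>f\<close> at radius \<open>r\<close>, hence by the supremum of these means, and \<open>r\<close> may tend to \<open>1\<close>. The
  constant obtained is \<open>2 * sqrt 6\<close>.
\<close>

section \<open>Hankel forms with kernel bounded in quadratic mean\<close>

text \<open>The one-step estimate behind the summation by parts below: for the weights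
  \<open>w t = 1 / (t * sqrt t)\<close>, the increment \<open>t * (w t - w (t + 1))\<close> is, for \<open>t \<ge> 1\<close>,
  comparable with \<open>w t\<close>, hence with the increment of \<open>1 / sqrt t\<close>, and the latter telescopes. With
  \<open>x = sqrt t\<close> and \<open>y = sqrt (t + 1)\<close> it reduces to
  \<open>y\<^sup>2 + x * y + x\<^sup>2 \<le> 3 * y\<^sup>2\<close>.\<close>
lemma inverse_sqrt_telescope:
  fixes t :: real
  assumes "t > 0"
  shows "t / (t * sqrt t) - t / ((t + 1) * sqrt (t + 1)) \<le> 3 * (1 / sqrt t - 1 / sqrt (t + 1))"
proof -
  define x where "x = sqrt t"
  define y where "y = sqrt (t + 1)"
  have xy: "0 < x" "x < y" and t: "t = x ^ 2" "t + 1 = y ^ 2"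
    using assms by (auto simp: x_def y_def)
  have "x ^ 2 / (x ^ 2 * x) - x ^ 2 / (y ^ 2 * y) = (y ^ 3 - x ^ 3) / (x * y ^ 3)"
    using xy by (simp add: field_simps power2_eq_square power3_eq_cube)
  also have "y ^ 3 - x ^ 3 = (y - x) * (y ^ 2 + x * y + x ^ 2)"
    by (simp add: algebra_simps power2_eq_square power3_eq_cube)
  also have "(y - x) * (y ^ 2 + x * y + x ^ 2) / (x * y ^ 3) \<le> (y - x) * (3 * y ^ 2) / (x * y ^ 3)"
  proof -
    have "x ^ 2 \<le> y ^ 2" "x * y \<le> y ^ 2"
      using xy by (auto simp: power2_eq_square intro!: mult_mono)
    hence "y ^ 2 + x * y + x ^ 2 \<le> 3 * y ^ 2" by linarith
    thus ?thesis using xy by (intro divide_right_mono mult_left_mono) auto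
  qed
  also have "\<dots> = 3 * (1 / x - 1 / y)"
    using xy by (simp add: field_simps power2_eq_square power3_eq_cube)
  finally show ?thesis
    unfolding x_def [symmetric] y_def [symmetric] using t by simp
qed

text \<open>Summation by parts: partial sums of linear growth mean that \<open>u\<close> is bounded on average,
  so the tail is no worse than that of the sum of \<open>(n + 1) powr (- 3 / 2)\<close>. The induction
  carries the boundary term \<open>w M * U M\<close> along, which avoids manipulating the summed-by-parts
  form itself.\<close>
lemma tail_bound:
  fixes u :: "nat \<Rightarrow> real"
  assumes nonneg: "\<And>n. 0 \<le> u n"
    and mean: "\<And>n. (\<Sum>i\<le>n. u i) \<le> B * (real n + 1)"
    and B: "0 \<le> B"
  shows "(\<Sum>n = k..M. u n / ((real n + 1) * sqrt (real n + 1))) \<le> 3 * B / sqrt (real k + 1)"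
proof (cases "k \<le> M")
  case True
  define w where "w n = 1 / ((real n + 1) * sqrt (real n + 1))" for n
  define U where "U n = (\<Sum>i\<le>n. u i)" for n
  have "(\<Sum>n = k..M. u n * w n)
      \<le> w M * U M + 3 * B * (1 / sqrt (real k + 1) - 1 / sqrt (real M + 1))"
    using True
  proof (induction M rule: dec_induct)
    case base
    have "u k \<le> U k"
      unfolding U_def by (rule member_le_sum) (auto simp: nonneg)
    hence "u k * w k \<le> U k * w k" by (intro mult_right_mono) (auto simp: w_def)
    thus ?case by (simp add: mult.commute)
  next
    case (step n)
    have wd: "0 \<le> w n - w (Suc n)"
      unfolding w_def by (auto intro!: divide_left_mono mult_mono mult_pos_pos)
    have "(w n - w (Suc n)) * U n \<le> (w n - w (Suc n)) * (B * (real n + 1))"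
      using wd mean[of n] by (intro mult_left_mono) (auto simp: U_def)
    also have "\<dots> = B * ((real n + 1) * w n - (real n + 1) * w (Suc n))"
      by (simp add: algebra_simps)
    also have "\<dots> \<le> B * (3 * (1 / sqrt (real n + 1) - 1 / sqrt (real (Suc n) + 1)))"
      using inverse_sqrt_telescope[of "real n + 1"] B
      by (intro mult_left_mono) (auto simp: w_def add_ac)
    finally have *: "w n * U n \<le> w (Suc n) * U n
        + 3 * B * (1 / sqrt (real n + 1) - 1 / sqrt (real (Suc n) + 1))"
      by (simp add: algebra_simps)
    have "(\<Sum>i = k..Suc n. u i * w i) = (\<Sum>i = k..n. u i * w i) + u (Suc n) * w (Suc n)"
      using step by simp
    moreover have "w (Suc n) * U (Suc n) = w (Suc n) * U n + u (Suc n) * w (Suc n)"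
      by (simp add: U_def algebra_simps)
    ultimately show ?case using step.IH * by (simp add: algebra_simps)
  qed
  also have "w M * U M \<le> w M * (B * (real M + 1))"
    using mean[of M] by (intro mult_left_mono) (auto simp: w_def U_def)
  also have "\<dots> = B / sqrt (real M + 1)"
    by (auto simp: w_def divide_simps)
  finally have "(\<Sum>n = k..M. u n * w n) \<le> 3 * B / sqrt (real k + 1) - 2 * B / sqrt (real M + 1)"
    by (simp add: algebra_simps diff_divide_distrib)
  moreover have "0 \<le> 2 * B / sqrt (real M + 1)" using B by simp
  ultimately show ?thesis by (simp add: w_def)
next
  case False
  thus ?thesis using B by simp
qed

lemma sum_inverse_sqrt_le:
  "(\<Sum>k\<le>m. 1 / sqrt (real k + 1)) \<le> 2 * sqrt (real m + 1)"
proof (induction m)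
  case (Suc m)
  define x where "x = sqrt (real m + 1)"
  define y where "y = sqrt (real m + 2)"
  have xy: "0 < x" "0 < y" "y ^ 2 = x ^ 2 + 1" by (auto simp: x_def y_def)
  have "0 \<le> (y - x) ^ 2" by simp
  hence "2 * x * y + 1 \<le> 2 * y ^ 2" using xy(3) by (simp add: power2_eq_square algebra_simps)
  hence "2 * x + 1 / y \<le> 2 * y" using xy by (simp add: field_simps power2_eq_square)
  thus ?case using Suc by (simp add: x_def y_def add_ac)
qed simp

text \<open>A Schur test with weights.
  Each product is split as
  \<open>(x k * c (k + m) * sqrt (s k * s m)) * (y m / sqrt (s k * s m))\<close> with \<open>s n = sqrt (n + 1)\<close>,
  and Cauchy--Schwarz is applied to the whole sum over \<open>k \<le> m\<close>. In the first factor,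
  for fixed \<open>k\<close>, the tail bound gives
  \<open>\<Sum>m\<ge>k. (c (k + m))\<^sup>2 * s m \<le> 3 * B / s k\<close>, which cancels the weight \<open>s k\<close>; in the
  second, for fixed \<open>m\<close>, \<open>\<Sum>k\<le>m. 1 / s k \<le> 2 * s m\<close> cancels the weight \<open>1 / s m\<close>.
  The kernel goes entirely into the first factor because only its squares are controlled, and
  the restriction to \<open>k \<le> m\<close> is what keeps the sum over \<open>k\<close> in the second factor
  proportional to \<open>s m\<close>.\<close>
lemma half_bilinear_bound:
  fixes x y c :: "nat \<Rightarrow> real"
  assumes mean: "\<And>n. (\<Sum>k\<le>n. (real k + 1)\<^sup>2 * (c k)\<^sup>2) \<le> B * (real n + 1)"
    and B: "0 \<le> B"
  shows "(\<Sum>k\<le>M. \<Sum>m = k..M. x k * y m * c (k + m))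
    \<le> sqrt (6 * B) * sqrt (\<Sum>k\<le>M. (x k)\<^sup>2) * sqrt (\<Sum>m\<le>M. (y m)\<^sup>2)"
proof -
  define s where "s n = sqrt (real n + 1)" for n :: nat
  have s: "s n > 0" "s n ^ 2 = real n + 1" for n by (auto simp: s_def)
  have smono: "m \<le> n \<Longrightarrow> s m \<le> s n" for m n by (simp add: s_def)
  define I where "I = (SIGMA k:{..M}. {k..M})"
  define P where "P = (\<lambda>(k, m). x k * c (k + m) * sqrt (s k * s m))"
  define Q where "Q = (\<lambda>(k, m). y m / sqrt (s k * s m))"
  have "(\<Sum>k\<le>M. \<Sum>m = k..M. x k * y m * c (k + m)) = (\<Sum>i\<in>I. P i * Q i)"
  proof -
    have "x k * y m * c (k + m) = P (k, m) * Q (k, m)" for k m :: nat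
    proof -
      have "s k \<noteq> 0" "s m \<noteq> 0" using s(1)[of k] s(1)[of m] by auto
      thus ?thesis by (simp add: P_def Q_def)
    qed
    thus ?thesis unfolding I_def by (subst sum.Sigma) (auto simp: case_prod_unfold)
  qed
  also have "\<dots> \<le> sqrt ((\<Sum>i\<in>I. P i * Q i)\<^sup>2)" by simp
  also have "\<dots> \<le> sqrt ((\<Sum>i\<in>I. (P i)\<^sup>2) * (\<Sum>i\<in>I. (Q i)\<^sup>2))"
    by (intro real_sqrt_le_mono Cauchy_Schwarz_ineq_sum)
  also have "\<dots> \<le> sqrt ((3 * B * (\<Sum>k\<le>M. (x k)\<^sup>2)) * (2 * (\<Sum>m\<le>M. (y m)\<^sup>2)))"
  proof (intro real_sqrt_le_mono mult_mono)
    have "(\<Sum>i\<in>I. (P i)\<^sup>2) = (\<Sum>k\<le>M. \<Sum>m = k..M. (x k)\<^sup>2 * s k * ((c (k + m))\<^sup>2 * s m))"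
      unfolding I_def
      by (subst sum.Sigma)
         (auto simp: P_def power_mult_distrib s(1) less_imp_le mult_ac intro!: sum.cong
            simp flip: real_sqrt_mult)
    also have "\<dots> \<le> (\<Sum>k\<le>M. (x k)\<^sup>2 * (3 * B))"
    proof (intro sum_mono)
      fix k
      \<comment> \<open>Enlarging the weight makes the summand a function of \<open>k + m\<close> alone.\<close>
      have "(\<Sum>m = k..M. (c (k + m))\<^sup>2 * s m) \<le> (\<Sum>m = k..M. (c (k + m))\<^sup>2 * s (k + m))"
        by (intro sum_mono mult_left_mono smono) auto
      also have "\<dots> = (\<Sum>n\<in>(+) k ` {k..M}. (c n)\<^sup>2 * s n)"
        by (subst sum.reindex) auto
      also have "\<dots> \<le> (\<Sum>n = k..k + M. (c n)\<^sup>2 * s n)"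
        by (intro sum_mono2) (auto simp: s(1) less_imp_le)
      also have "\<dots> = (\<Sum>n = k..k + M. ((real n + 1)\<^sup>2 * (c n)\<^sup>2) / ((real n + 1) * sqrt (real n + 1)))"
      proof (intro sum.cong refl)
        fix n
        have "(real n + 1)\<^sup>2 * (c n)\<^sup>2 / ((real n + 1) * sqrt (real n + 1))
            = (s n ^ 2)\<^sup>2 * (c n)\<^sup>2 / (s n ^ 2 * s n)" by (simp add: s(2)) (simp add: s_def)
        also have "\<dots> = (c n)\<^sup>2 * s n"
          using s(1)[of n] by (simp add: field_simps power2_eq_square)
        finally show "(c n)\<^sup>2 * s n
            = (real n + 1)\<^sup>2 * (c n)\<^sup>2 / ((real n + 1) * sqrt (real n + 1))" by simp
      qed
      also have "\<dots> \<le> 3 * B / sqrt (real k + 1)"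
        by (rule tail_bound) (use mean B in auto)
      finally have "(\<Sum>m = k..M. (c (k + m))\<^sup>2 * s m) \<le> 3 * B / s k" by (simp add: s_def)
      hence "(x k)\<^sup>2 * s k * (\<Sum>m = k..M. (c (k + m))\<^sup>2 * s m) \<le> (x k)\<^sup>2 * s k * (3 * B / s k)"
        using s(1)[of k] by (intro mult_left_mono) auto
      also have "\<dots> = (x k)\<^sup>2 * (3 * B)" using s(1)[of k] by simp
      finally show "(\<Sum>m = k..M. (x k)\<^sup>2 * s k * ((c (k + m))\<^sup>2 * s m)) \<le> (x k)\<^sup>2 * (3 * B)"
        by (simp add: sum_distrib_left)
    qed
    finally show "(\<Sum>i\<in>I. (P i)\<^sup>2) \<le> 3 * B * (\<Sum>k\<le>M. (x k)\<^sup>2)"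
      by (simp add: sum_distrib_left mult_ac)
  next
    have "(\<Sum>i\<in>I. (Q i)\<^sup>2) = (\<Sum>k\<le>M. \<Sum>m = k..M. (y m)\<^sup>2 / s m * (1 / s k))"
      unfolding I_def
      by (subst sum.Sigma)
         (auto simp: Q_def power_divide s(1) less_imp_le mult_ac intro!: sum.cong
            simp flip: real_sqrt_mult)
    also have "\<dots> = (\<Sum>m\<le>M. \<Sum>k\<le>m. (y m)\<^sup>2 / s m * (1 / s k))"
      by (subst sum.Sigma, simp, simp, subst sum.Sigma, simp, simp,
          rule sum.reindex_bij_witness[of _ prod.swap prod.swap]) auto
    also have "\<dots> \<le> (\<Sum>m\<le>M. 2 * (y m)\<^sup>2)"
    proof (intro sum_mono)
      fix m
      have "(\<Sum>k\<le>m. 1 / s k) \<le> 2 * s m"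
        unfolding s_def by (rule sum_inverse_sqrt_le)
      hence "(y m)\<^sup>2 / s m * (\<Sum>k\<le>m. 1 / s k) \<le> (y m)\<^sup>2 / s m * (2 * s m)"
        using s(1)[of m] by (intro mult_left_mono) auto
      thus "(\<Sum>k\<le>m. (y m)\<^sup>2 / s m * (1 / s k)) \<le> 2 * (y m)\<^sup>2"
        using s(1)[of m] by (simp add: sum_distrib_left)
    qed
    finally show "(\<Sum>i\<in>I. (Q i)\<^sup>2) \<le> 2 * (\<Sum>m\<le>M. (y m)\<^sup>2)"
      by (simp add: sum_distrib_left)
  qed (use B in \<open>auto intro!: sum_nonneg mult_nonneg_nonneg\<close>)
  also have "\<dots> = sqrt (6 * B) * sqrt (\<Sum>k\<le>M. (x k)\<^sup>2) * sqrt (\<Sum>m\<le>M. (y m)\<^sup>2)"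
    by (simp add: mult_ac flip: real_sqrt_mult)
  finally show ?thesis .
qed

text \<open>The index set \<open>k + m \<le> M\<close> is covered by its halves \<open>k \<le> m\<close> and \<open>m \<le> k\<close>; the second
  half is the first with \<open>x\<close> and \<open>y\<close> exchanged, because the kernel depends only on
  \<open>k + m\<close>. The surplus terms are harmless since they are nonnegative.\<close>
lemma hankel_bound:
  fixes x y c :: "nat \<Rightarrow> real"
  assumes mean: "\<And>n. (\<Sum>k\<le>n. (real k + 1)\<^sup>2 * (c k)\<^sup>2) \<le> B * (real n + 1)"
    and B: "0 \<le> B"
    and nonneg: "\<And>n. 0 \<le> x n" "\<And>n. 0 \<le> y n" "\<And>n. 0 \<le> c n"
  shows "(\<Sum>n\<le>M. \<Sum>k\<le>n. x k * y (n - k) * c n)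
    \<le> 2 * sqrt (6 * B) * sqrt (\<Sum>k\<le>M. (x k)\<^sup>2) * sqrt (\<Sum>m\<le>M. (y m)\<^sup>2)"
proof -
  let ?t = "\<lambda>(k, m). x k * y m * c (k + m)"
  have t: "0 \<le> ?t i" for i using nonneg by (cases i) auto
  define I where "I = (SIGMA k:{..M}. {k..M})"
  define J where "J = prod.swap ` I"
  have fin: "finite I" "finite J" by (auto simp: I_def J_def)
  have "(\<Sum>n\<le>M. \<Sum>k\<le>n. x k * y (n - k) * c n)
      = (\<Sum>i\<in>{(k, m). k + m \<le> M}. ?t i)"
    by (subst sum.Sigma, simp, simp,
        rule sum.reindex_bij_witness[of _ "\<lambda>(k, m). (k + m, k)" "\<lambda>(n, k). (k, n - k)"]) auto
  also have "\<dots> \<le> (\<Sum>i\<in>I \<union> J. ?t i)"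
    by (intro sum_mono2) (use fin t in \<open>auto simp: I_def J_def image_iff\<close>)
  also have "\<dots> \<le> (\<Sum>i\<in>I. ?t i) + (\<Sum>i\<in>J. ?t i)"
    using sum.union_inter[OF fin, of ?t] sum_nonneg[of "I \<inter> J" ?t] t by simp
  also have "(\<Sum>i\<in>I. ?t i) = (\<Sum>k\<le>M. \<Sum>m = k..M. x k * y m * c (k + m))"
    unfolding I_def by (subst sum.Sigma) auto
  also have "\<dots> \<le> sqrt (6 * B) * sqrt (\<Sum>k\<le>M. (x k)\<^sup>2) * sqrt (\<Sum>m\<le>M. (y m)\<^sup>2)"
    by (rule half_bilinear_bound[OF mean B])
  also have "(\<Sum>i\<in>J. ?t i) = (\<Sum>k\<le>M. \<Sum>m = k..M. y k * x m * c (k + m))"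
    unfolding J_def I_def
    by (subst sum.reindex, simp, subst sum.Sigma)
       (auto intro!: sum.cong simp: add.commute)
  also have "\<dots> \<le> sqrt (6 * B) * sqrt (\<Sum>k\<le>M. (y k)\<^sup>2) * sqrt (\<Sum>m\<le>M. (x m)\<^sup>2)"
    by (rule half_bilinear_bound[OF mean B])
  finally show ?thesis by (simp add: mult_ac)
qed

section \<open>Balanced factorization of polynomials\<close>

text \<open>The point at issue is \<open>0\<close>, which lies on the branch cut: it is reached by
  \<open>1 - z / w\<close> when the zero \<open>w\<close> of a linear factor lies on the unit circle.\<close>
lemma continuous_on_csqrt_halfplane: "continuous_on {z. 0 \<le> Re z} csqrt"
proof (rule continuous_on_eq_continuous_within [THEN iffD2], rule ballI)
  fix z :: complex
  assume z: "z \<in> {z. 0 \<le> Re z}"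
  show "continuous (at z within {z. 0 \<le> Re z}) csqrt"
  proof (cases "z = 0")
    case True
    have "((\<lambda>w. sqrt (cmod w)) \<longlongrightarrow> sqrt (cmod 0)) (at 0 within {z. 0 \<le> Re z})"
      by (intro tendsto_intros)
    hence "((\<lambda>w. cmod (csqrt w)) \<longlongrightarrow> 0) (at 0 within {z. 0 \<le> Re z})" by simp
    hence "(csqrt \<longlongrightarrow> 0) (at 0 within {z. 0 \<le> Re z})" by (rule tendsto_norm_zero_cancel)
    thus ?thesis using True by (simp add: continuous_within)
  next
    case False
    hence "z \<notin> \<real>\<^sub>\<le>\<^sub>0" using z by (auto simp: complex_nonpos_Reals_iff complex_eq_iff)
    thus ?thesis by (rule continuous_within_csqrt)
  qed
qed

text \<open>The factors of equal modulus on the circle play the role of \<open>B * G\<close> and \<open>G\<close> in the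
  factorization \<open>f = B * G\<^sup>2\<close> of a Hardy space function with Blaschke product \<open>B\<close>. Boundary
  values are taken by continuity, so radial limits do not enter.\<close>
definition balanced_factors :: "(complex \<Rightarrow> complex) \<Rightarrow> (complex \<Rightarrow> complex) \<Rightarrow> (complex \<Rightarrow> complex) \<Rightarrow> bool"
  where "balanced_factors f g h \<longleftrightarrow>
    g holomorphic_on ball 0 1 \<and> continuous_on (cball 0 1) g \<and>
    h holomorphic_on ball 0 1 \<and> continuous_on (cball 0 1) h \<and>
    (\<forall>z\<in>cball 0 1. f z = g z * h z) \<and> (\<forall>z\<in>sphere 0 1. cmod (g z) = cmod (h z))"

lemma balanced_factors_mult:
  assumes "balanced_factors f1 g1 h1" "balanced_factors f2 g2 h2"
  shows "balanced_factors (\<lambda>z. f1 z * f2 z) (\<lambda>z. g1 z * g2 z) (\<lambda>z. h1 z * h2 z)"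
  using assms unfolding balanced_factors_def
  by (auto intro!: holomorphic_intros continuous_intros simp: norm_mult)

lemma balanced_factors_const: "balanced_factors (\<lambda>z. b) (\<lambda>z. csqrt b) (\<lambda>z. csqrt b)"
  unfolding balanced_factors_def
  by (auto intro!: holomorphic_intros continuous_intros simp flip: power2_eq_square)

text \<open>A factor without zeros in the open disc is the square of a holomorphic function:
  \<open>1 - z / w\<close> has nonnegative real part on the closed disc.\<close>
lemma balanced_factors_linear_outside:
  assumes w: "1 \<le> cmod w"
  shows "\<exists>g h. balanced_factors (\<lambda>z. z - w) g h"
proof -
  define q where "q z = csqrt (1 - z / w)" for z
  have w0: "w \<noteq> 0" using w by auto
  have Re: "Re (1 - z / w) \<ge> 1 - cmod z" for z
  proof -
    have "Re (z / w) \<le> cmod (z / w)" by (rule complex_Re_le_cmod)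
    also have "\<dots> \<le> cmod z / 1"
      unfolding norm_divide using w by (intro divide_left_mono) auto
    finally show ?thesis by simp
  qed
  have "q holomorphic_on ball 0 1"
    unfolding q_def
  proof (intro holomorphic_intros)
    fix z assume "z \<in> ball (0::complex) 1"
    hence "Re (1 - z / w) > 0" using Re[of z] by (simp add: dist_norm)
    thus "1 - z / w \<notin> \<real>\<^sub>\<le>\<^sub>0" by (auto simp: complex_nonpos_Reals_iff)
  qed (use w0 in auto)
  moreover have "continuous_on (cball 0 1) q"
    unfolding q_def
  proof (rule continuous_on_compose2[OF continuous_on_csqrt_halfplane])
    show "(\<lambda>z. 1 - z / w) ` cball 0 1 \<subseteq> {z. 0 \<le> Re z}"
    proof safe
      fix z assume "z \<in> cball (0::complex) 1"
      thus "0 \<le> Re (1 - z / w)" using Re[of z] by (simp add: dist_norm)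
    qed
  qed (use w0 in \<open>auto intro!: continuous_intros\<close>)
  moreover have "q z * q z = 1 - z / w" for z
    by (simp add: q_def flip: power2_eq_square)
  ultimately have "balanced_factors (\<lambda>z. 1 - z / w) q q"
    unfolding balanced_factors_def by auto
  from balanced_factors_mult[OF balanced_factors_const[of "- w"] this] w0
  show ?thesis by (auto simp: algebra_simps)
qed

text \<open>Dividing by \<open>1 - cnj w * z\<close> would turn \<open>z - w\<close> into a Blaschke factor of modulus \<open>1\<close>
  on the circle. Distributing the square root \<open>q\<close> of \<open>1 - cnj w * z\<close>, which has positive
  real part, gives \<open>z - w = ((z - w) / q) * q\<close> with factors of equal modulus there.\<close>
lemma balanced_factors_linear_inside:
  assumes w: "cmod w < 1"
  shows "\<exists>g h. balanced_factors (\<lambda>z. z - w) g h"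
proof -
  define q where "q z = csqrt (1 - cnj w * z)" for z
  have Re: "Re (1 - cnj w * z) > 0" if "z \<in> cball 0 1" for z
  proof -
    have "Re (cnj w * z) \<le> cmod (cnj w * z)" by (rule complex_Re_le_cmod)
    also have "\<dots> = cmod w * cmod z" by (simp add: norm_mult)
    also have "\<dots> \<le> cmod w * 1" using that by (intro mult_left_mono) auto
    finally show ?thesis using w by simp
  qed
  have q2: "q z * q z = 1 - cnj w * z" for z
    by (simp add: q_def flip: power2_eq_square)
  have q0: "q z \<noteq> 0" if "z \<in> cball 0 1" for z
  proof -
    have "Re (q z * q z) > 0" using Re[OF that] q2[of z] by simp
    thus ?thesis by auto
  qed
  have hol: "q holomorphic_on ball 0 1"
    unfolding q_def
  proof (intro holomorphic_intros)
    fix z assume "z \<in> ball (0::complex) 1"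
    thus "1 - cnj w * z \<notin> \<real>\<^sub>\<le>\<^sub>0" using Re[of z] by (auto simp: complex_nonpos_Reals_iff)
  qed
  have cont: "continuous_on (cball 0 1) q"
    unfolding q_def
  proof (rule continuous_on_compose2[OF continuous_on_csqrt_halfplane])
    show "(\<lambda>z. 1 - cnj w * z) ` cball 0 1 \<subseteq> {z. 0 \<le> Re z}"
      using Re less_imp_le by blast
  qed (intro continuous_intros)
  have "cmod ((z - w) / q z) = cmod (q z)" if "z \<in> sphere 0 1" for z
  proof -
    have "z * cnj z = 1" using that by (simp add: complex_norm_square [symmetric])
    hence "1 - cnj w * z = z * cnj (z - w)" by (simp add: algebra_simps)
    hence "cmod (1 - cnj w * z) = cmod (z - w)"
      using that by (simp add: norm_mult flip: complex_cnj_diff)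
    hence "cmod (z - w) = cmod (q z) * cmod (q z)" by (simp flip: q2 norm_mult)
    thus ?thesis using q0[of z] that by (simp add: norm_divide)
  qed
  hence "balanced_factors (\<lambda>z. z - w) (\<lambda>z. (z - w) / q z) q"
    unfolding balanced_factors_def using hol cont q0
    by (auto intro!: holomorphic_intros continuous_intros)
  thus ?thesis by blast
qed

text \<open>Balanced factorizations multiply, so it is enough to split the polynomial into linear
  factors.\<close>
lemma poly_balanced_factors:
  fixes p :: "complex poly"
  shows "\<exists>g h. balanced_factors (poly p) g h"
proof (induction p rule: poly_root_induct[where P = "\<lambda>_. True"])
  case 0
  show ?case using balanced_factors_const[of 0] by (auto simp: fun_eq_iff)
next
  case (no_roots p)
  then obtain b where "p = [:b:]"
    using alg_closed_imp_poly_has_root[of p] by (auto elim: degree_eq_zeroE)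
  thus ?case using balanced_factors_const[of b] by auto
next
  case (root w p)
  then obtain g h where "balanced_factors (poly p) g h" by blast
  moreover obtain g' h' where "balanced_factors (\<lambda>z. z - w) g' h'"
    using balanced_factors_linear_inside[of w] balanced_factors_linear_outside[of w]
    by (cases "cmod w < 1") (blast, fastforce)
  ultimately have "balanced_factors (\<lambda>z. - 1 * ((z - w) * poly p z))
      (\<lambda>z. csqrt (- 1) * (g' z * g z)) (\<lambda>z. csqrt (- 1) * (h' z * h z))"
    by (intro balanced_factors_mult balanced_factors_const)
  moreover have "poly ([:w, - 1:] * p) = (\<lambda>z. - 1 * ((z - w) * poly p z))"
    by (rule ext) (simp add: algebra_simps)
  ultimately have "balanced_factors (poly ([:w, - 1:] * p))
      (\<lambda>z. csqrt (- 1) * (g' z * g z)) (\<lambda>z. csqrt (- 1) * (h' z * h z))"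
    by (simp only:)
  thus ?case by blast
qed

section \<open>Circle means and Taylor coefficients\<close>

lemma circle_mean_nonneg: "0 \<le> circle_mean f r"
proof -
  let ?f = "\<lambda>\<theta>. cmod (f (of_real r * exp (\<i> * of_real \<theta>)))"
  have "0 \<le> integral {0..2 * pi} ?f"
    by (cases "?f integrable_on {0..2 * pi}") (auto intro: integral_nonneg simp: not_integrable_integral)
  thus ?thesis by (simp add: circle_mean_def)
qed

lemma circle_mean_cong:
  assumes "\<And>z. cmod z = \<bar>r\<bar> \<Longrightarrow> cmod (f z) = cmod (g z)"
  shows "circle_mean f r = circle_mean g r"
  unfolding circle_mean_def by (intro arg_cong2[of _ _ _ _ "(*)"] integral_cong refl assms) (simp add: norm_mult)

lemma continuous_on_circle_mean:
  assumes "continuous_on (cball 0 1) f"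
  shows "continuous_on {0..1} (circle_mean f)"
proof -
  have "continuous_on ({0..1} \<times> cbox 0 (2 * pi))
      (\<lambda>(r, \<theta>). cmod (f (of_real r * exp (\<i> * of_real \<theta>))))"
    unfolding case_prod_unfold
    by (intro continuous_on_norm continuous_on_compose2[OF assms] continuous_intros)
       (auto simp: norm_mult)
  from integral_continuous_on_param[OF this] show ?thesis
    unfolding circle_mean_def by (intro continuous_intros) simp
qed

lemma circle_mean_uniform_limit:
  assumes cont: "\<And>n. continuous_on (sphere 0 r) (F n)"
    and lim: "uniform_limit (sphere 0 r) F f sequentially"
    and r: "0 \<le> r"
  shows "(\<lambda>n. circle_mean (F n) r) \<longlonglongrightarrow> circle_mean f r"
proof -
  have "uniform_limit {0..2 * pi} (\<lambda>n \<theta>. cmod (F n (of_real r * exp (\<i> * of_real \<theta>))))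
      (\<lambda>\<theta>. cmod (f (of_real r * exp (\<i> * of_real \<theta>)))) sequentially"
    by (intro uniform_limit_norm uniform_limit_compose'[OF lim]) (use r in \<open>auto simp: norm_mult\<close>)
  moreover have "continuous_on {0..2 * pi} (\<lambda>\<theta>. cmod (F n (of_real r * exp (\<i> * of_real \<theta>))))" for n
    by (intro continuous_on_norm continuous_on_compose2[OF cont] continuous_intros)
       (use r in \<open>auto simp: norm_mult\<close>)
  ultimately obtain I J where IJ:
    "\<And>n. ((\<lambda>\<theta>. cmod (F n (of_real r * exp (\<i> * of_real \<theta>)))) has_integral I n) {0..2 * pi}"
    "((\<lambda>\<theta>. cmod (f (of_real r * exp (\<i> * of_real \<theta>)))) has_integral J) {0..2 * pi}"
    "I \<longlonglongrightarrow> J"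
    using uniform_limit_integral[OF _ _ sequentially_bot] by blast
  have "circle_mean (F n) r = 1 / (2 * pi) * I n" for n
    unfolding circle_mean_def by (subst integral_unique[OF IJ(1)]) simp
  moreover have "circle_mean f r = 1 / (2 * pi) * J"
    unfolding circle_mean_def by (subst integral_unique[OF IJ(2)]) simp
  ultimately show ?thesis using IJ(3) by (auto intro!: tendsto_intros)
qed

lemma power_series_uniform_limit_sphere:
  fixes b :: "nat \<Rightarrow> complex"
  assumes sums: "\<And>z. z \<in> ball 0 1 \<Longrightarrow> (\<lambda>n. b n * z ^ n) sums g z"
    and r: "0 \<le> r" "r < 1"
  shows "uniform_limit (sphere 0 r) (\<lambda>n z. \<Sum>k<n. b k * z ^ k) g sequentially"
proof -
  have "ereal r < conv_radius b"
  proof -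
    obtain s where s: "r < s" "s < 1" using r dense by blast
    have "summable (\<lambda>n. b n * of_real s ^ n)"
      using sums[of "of_real s"] s r by (auto simp: sums_iff)
    hence "norm (of_real s :: complex) \<le> conv_radius b" by (rule conv_radius_geI)
    thus ?thesis using s r by (auto intro: less_le_trans[of _ "ereal s"])
  qed
  from powser_uniform_limit[OF this, of 0]
  have "uniform_limit (cball 0 r) (\<lambda>n z. \<Sum>k<n. b k * z ^ k) (\<lambda>z. \<Sum>k. b k * z ^ k) sequentially"
    by simp
  hence "uniform_limit (sphere 0 r) (\<lambda>n z. \<Sum>k<n. b k * z ^ k) (\<lambda>z. \<Sum>k. b k * z ^ k) sequentially"
    by (rule uniform_limit_on_subset) auto
  moreover have "(\<Sum>k. b k * z ^ k) = g z" if "z \<in> sphere 0 r" for z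
    using sums[of z] that r by (simp add: sums_iff)
  ultimately show ?thesis by (subst (asm) uniform_limit_cong'[where g = "\<lambda>n z. \<Sum>k<n. b k * z ^ k" and i = g]) auto
qed

text \<open>Orthogonality of the characters of the circle.\<close>
lemma has_integral_exp_int:
  "((\<lambda>\<theta>. exp (\<i> * of_real (of_int m * \<theta>))) has_integral (if m = 0 then 2 * pi else 0)) {0..2 * pi}"
proof (cases "m = 0")
  case True
  have "((\<lambda>\<theta>. 1 :: complex) has_integral (2 * pi)) {0..2 * pi}"
    using has_integral_const_real[of "1::complex" 0 "2 * pi"] by (simp add: scaleR_conv_of_real)
  thus ?thesis using True by simp
next
  case False
  have "((\<lambda>\<theta>. exp (\<i> * of_real (of_int m * \<theta>))) has_integral
      (exp (\<i> * of_real (of_int m * (2 * pi))) / (\<i> * of_int m)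
        - exp (\<i> * of_real (of_int m * 0)) / (\<i> * of_int m))) {0..2 * pi}"
  proof (rule fundamental_theorem_of_calculus)
    fix x :: real
    have "((\<lambda>z. exp (\<i> * (of_int m * z)) / (\<i> * of_int m)) has_field_derivative
        exp (\<i> * (of_int m * of_real x))) (at (of_real x))"
      using False by (auto intro!: derivative_eq_intros simp: mult_ac)
    from has_vector_derivative_real_field[OF this]
    show "((\<lambda>\<theta>. exp (\<i> * of_real (of_int m * \<theta>)) / (\<i> * of_int m)) has_vector_derivative
        exp (\<i> * of_real (of_int m * x))) (at x within {0..2 * pi})"
      by simp
  qed simp
  moreover have "exp (\<i> * of_real (of_int m * (2 * pi))) = 1"
    by (subst exp_eq_1) auto
  ultimately show ?thesis using False by simp
qed

text \<open>Parseval's identity for polynomials. The squared modulus is written as the mean of the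
  modulus of the square, so that the same functional \<^const>\<open>circle_mean\<close> serves for both the
  \<open>L\<^sup>1\<close> and the \<open>L\<^sup>2\<close> norm.\<close>
lemma circle_mean_square_polynomial:
  fixes b :: "nat \<Rightarrow> complex"
  shows "circle_mean (\<lambda>z. (\<Sum>k<n. b k * z ^ k)\<^sup>2) r = (\<Sum>k<n. (cmod (b k))\<^sup>2 * r ^ (2 * k))"
proof -
  let ?e = "\<lambda>\<theta>. of_real r * exp (\<i> * of_real \<theta>) :: complex"
  have sq: "complex_of_real (cmod ((\<Sum>k<n. b k * ?e \<theta> ^ k)\<^sup>2))
      = (\<Sum>j<n. \<Sum>k<n. b j * cnj (b k) * of_real r ^ (j + k)
           * exp (\<i> * of_real (of_int (int j - int k) * \<theta>)))" for \<theta>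
  proof -
    have "complex_of_real (cmod ((\<Sum>k<n. b k * ?e \<theta> ^ k)\<^sup>2))
        = (\<Sum>j<n. b j * ?e \<theta> ^ j) * cnj (\<Sum>k<n. b k * ?e \<theta> ^ k)"
      by (simp only: norm_power complex_norm_square)
    also have "\<dots> = (\<Sum>j<n. \<Sum>k<n. (b j * ?e \<theta> ^ j) * cnj (b k * ?e \<theta> ^ k))"
      by (simp only: cnj_sum sum_product)
    also have "\<dots> = (\<Sum>j<n. \<Sum>k<n. b j * cnj (b k) * of_real r ^ (j + k)
           * exp (\<i> * of_real (of_int (int j - int k) * \<theta>)))"
    proof (intro sum.cong refl)
      fix j k
      have "exp (\<i> * of_real \<theta>) ^ j * exp (- (\<i> * of_real \<theta>)) ^ k
          = exp (\<i> * of_real (of_int (int j - int k) * \<theta>))"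
        by (simp add: algebra_simps flip: exp_of_nat_mult exp_add)
      thus "(b j * ?e \<theta> ^ j) * cnj (b k * ?e \<theta> ^ k) = b j * cnj (b k) * of_real r ^ (j + k)
           * exp (\<i> * of_real (of_int (int j - int k) * \<theta>))"
        by (simp add: power_mult_distrib power_add exp_cnj mult_ac)
    qed
    finally show ?thesis .
  qed
  have int: "((\<lambda>\<theta>. exp (\<i> * of_real (of_int (int j - int k) * \<theta>))) has_integral
      (if k = j then of_real (2 * pi) else 0)) {0..2 * pi}" for j k
    using has_integral_exp_int[of "int j - int k"] by (cases "k = j") auto
  have "((\<lambda>\<theta>. \<Sum>j<n. \<Sum>k<n. b j * cnj (b k) * of_real r ^ (j + k)
           * exp (\<i> * of_real (of_int (int j - int k) * \<theta>))) has_integral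
      (\<Sum>j<n. \<Sum>k<n. b j * cnj (b k) * of_real r ^ (j + k)
           * (if k = j then of_real (2 * pi) else 0))) {0..2 * pi}"
    by (intro has_integral_sum has_integral_mult_right int) auto
  moreover have "(\<Sum>k<n. b j * cnj (b k) * of_real r ^ (j + k) * (if k = j then of_real (2 * pi) else 0))
      = of_real (2 * pi * ((cmod (b j))\<^sup>2 * r ^ (2 * j)))" if j: "j < n" for j
  proof -
    have "(\<Sum>k<n. b j * cnj (b k) * of_real r ^ (j + k) * (if k = j then of_real (2 * pi) else 0))
        = (\<Sum>k<n. if k = j then b j * cnj (b j) * of_real r ^ (2 * j) * of_real (2 * pi) else 0)"
    proof (rule sum.cong[OF refl])
      fix k
      show "b j * cnj (b k) * of_real r ^ (j + k) * (if k = j then of_real (2 * pi) else 0)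
        = (if k = j then b j * cnj (b j) * of_real r ^ (2 * j) * of_real (2 * pi) else 0)"
        by (cases "k = j") (simp_all only: if_True if_False mult_zero_right mult_2 simp_thms)
    qed
    also have "\<dots> = (b j * cnj (b j)) * of_real r ^ (2 * j) * of_real (2 * pi)"
      using j by (subst sum.delta) (simp_all only: finite_lessThan lessThan_iff if_True)
    also have "\<dots> = of_real (2 * pi * ((cmod (b j))\<^sup>2 * r ^ (2 * j)))"
      by (simp only: complex_norm_square [symmetric] of_real_mult of_real_power mult_ac)
    finally show ?thesis .
  qed
  hence "(\<Sum>j<n. \<Sum>k<n. b j * cnj (b k) * of_real r ^ (j + k) * (if k = j then of_real (2 * pi) else 0))
      = (\<Sum>j<n. of_real (2 * pi * ((cmod (b j))\<^sup>2 * r ^ (2 * j))))"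
    by (intro sum.cong[OF refl]) (simp only: lessThan_iff)
  ultimately have "((\<lambda>\<theta>. complex_of_real (cmod ((\<Sum>k<n. b k * ?e \<theta> ^ k)\<^sup>2))) has_integral
      (\<Sum>j<n. of_real (2 * pi * ((cmod (b j))\<^sup>2 * r ^ (2 * j))))) {0..2 * pi}"
    by (simp only: sq)
  hence "((\<lambda>\<theta>. complex_of_real (cmod ((\<Sum>k<n. b k * ?e \<theta> ^ k)\<^sup>2))) has_integral
      of_real (2 * pi * (\<Sum>k<n. (cmod (b k))\<^sup>2 * r ^ (2 * k)))) {0..2 * pi}"
    by (simp only: sum_distrib_left of_real_sum)
  hence "((\<lambda>\<theta>. cmod ((\<Sum>k<n. b k * ?e \<theta> ^ k)\<^sup>2)) has_integral
      (2 * pi * (\<Sum>k<n. (cmod (b k))\<^sup>2 * r ^ (2 * k)))) {0..2 * pi}"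
    by (auto dest: has_integral_linear[OF _ bounded_linear_Re] simp: o_def simp del: of_real_mult of_real_sum)
  hence "integral {0..2 * pi} (\<lambda>\<theta>. cmod ((\<Sum>k<n. b k * ?e \<theta> ^ k)\<^sup>2))
      = 2 * pi * (\<Sum>k<n. (cmod (b k))\<^sup>2 * r ^ (2 * k))"
    by (rule integral_unique)
  thus ?thesis
    by (simp only: circle_mean_def) simp
qed

text \<open>The partial sums converge uniformly on a circle of radius less than \<open>1\<close>, so Parseval's
  identity for them passes to the limit; the left-hand side is then a partial sum of the
  limiting series.\<close>
lemma bessel_circle:
  fixes b :: "nat \<Rightarrow> complex"
  assumes sums: "\<And>z. z \<in> ball 0 1 \<Longrightarrow> (\<lambda>n. b n * z ^ n) sums g z"
    and r: "0 \<le> r" "r < 1"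
  shows "(\<Sum>k<K. (cmod (b k))\<^sup>2 * r ^ (2 * k)) \<le> circle_mean (\<lambda>z. (g z)\<^sup>2) r"
proof -
  let ?P = "\<lambda>n z. \<Sum>k<n. b k * z ^ k"
  have lim: "uniform_limit (sphere 0 r) ?P g sequentially"
    by (rule power_series_uniform_limit_sphere[OF sums r])
  have "continuous_on (sphere 0 r) g"
    by (rule uniform_limit_theorem[OF _ lim]) (auto intro!: continuous_intros always_eventually)
  hence "bounded (g ` sphere 0 r)"
    by (intro compact_imp_bounded compact_continuous_image) auto
  hence "uniform_limit (sphere 0 r) (\<lambda>n z. (?P n z)\<^sup>2) (\<lambda>z. (g z)\<^sup>2) sequentially"
    unfolding power2_eq_square by (intro uniform_lim_mult lim)
  hence "(\<lambda>n. circle_mean (\<lambda>z. (?P n z)\<^sup>2) r) \<longlonglongrightarrow> circle_mean (\<lambda>z. (g z)\<^sup>2) r"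
    by (intro circle_mean_uniform_limit r) (auto intro!: continuous_intros)
  hence lim': "(\<lambda>n. \<Sum>k<n. (cmod (b k))\<^sup>2 * r ^ (2 * k)) \<longlonglongrightarrow> circle_mean (\<lambda>z. (g z)\<^sup>2) r"
    by (simp only: circle_mean_square_polynomial)
  have "(\<Sum>k<K. (cmod (b k))\<^sup>2 * r ^ (2 * k)) \<le> (\<Sum>k<n. (cmod (b k))\<^sup>2 * r ^ (2 * k))" if "n \<ge> K" for n
    by (intro sum_mono2) (use that r in auto)
  thus ?thesis
    by (intro tendsto_lowerbound[OF lim'] eventually_sequentiallyI) auto
qed

text \<open>Nothing is known about the convergence of the power series on the unit circle itself, so the
  inequality is obtained there by letting the radius tend to \<open>1\<close>; continuity of \<open>g\<close> up to
  the boundary makes the circle means converge.\<close>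
lemma bessel_unit_circle:
  fixes b :: "nat \<Rightarrow> complex"
  assumes sums: "\<And>z. z \<in> ball 0 1 \<Longrightarrow> (\<lambda>n. b n * z ^ n) sums g z"
    and cont: "continuous_on (cball 0 1) g"
  shows "(\<Sum>k\<le>K. (cmod (b k))\<^sup>2) \<le> circle_mean (\<lambda>z. (g z)\<^sup>2) 1"
proof -
  have "continuous_on {0..1} (circle_mean (\<lambda>z. (g z)\<^sup>2))"
    by (intro continuous_on_circle_mean continuous_intros cont)
  hence "((circle_mean (\<lambda>z. (g z)\<^sup>2)) \<longlongrightarrow> circle_mean (\<lambda>z. (g z)\<^sup>2) 1) (at_left 1)"
    by (simp add: continuous_on_Icc_at_leftD)
  moreover have "((\<lambda>r. \<Sum>k<Suc K. (cmod (b k))\<^sup>2 * r ^ (2 * k))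
      \<longlongrightarrow> (\<Sum>k<Suc K. (cmod (b k))\<^sup>2 * 1 ^ (2 * k))) (at_left (1::real))"
    by (intro tendsto_intros)
  moreover have "eventually (\<lambda>r. (\<Sum>k<Suc K. (cmod (b k))\<^sup>2 * r ^ (2 * k))
      \<le> circle_mean (\<lambda>z. (g z)\<^sup>2) r) (at_left (1::real))"
    using eventually_at_left_real[OF zero_less_one]
    by (rule eventually_mono) (use bessel_circle[OF sums, of _ "Suc K"] in \<open>auto simp del: sum.lessThan_Suc\<close>)
  ultimately have "(\<Sum>k<Suc K. (cmod (b k))\<^sup>2 * 1 ^ (2 * k)) \<le> circle_mean (\<lambda>z. (g z)\<^sup>2) 1"
    by (intro tendsto_le[of "at_left (1::real)"]) auto
  thus ?thesis by (simp add: lessThan_Suc_atMost)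
qed

section \<open>Coefficient multipliers on the Hardy space\<close>

text \<open>With \<open>p = g * h\<close> balanced, the coefficients of \<open>p\<close> are convolutions of those of \<open>g\<close> and
  \<open>h\<close>, so the left-hand side is dominated by the Hankel form with kernel \<open>\<bar>c (k + m)\<bar>\<close>. Balance
  gives \<open>\<bar>g\<bar>\<^sup>2 = \<bar>h\<bar>\<^sup>2 = \<bar>p\<bar>\<close> on the circle, and Bessel's inequality bounds both coefficient
  sequences in \<open>l\<^sup>2\<close> by the square root of the \<open>L\<^sup>1\<close> mean of \<open>p\<close>.\<close>
lemma polynomial_multiplier_bound:
  fixes p :: "complex poly" and c :: "nat \<Rightarrow> complex"
  assumes mean: "\<And>n. (\<Sum>k\<le>n. (real k + 1)\<^sup>2 * (cmod (c k))\<^sup>2) \<le> B * (real n + 1)"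
    and B: "0 \<le> B"
  shows "(\<Sum>n\<le>M. cmod (poly.coeff p n * c n)) \<le> 2 * sqrt (6 * B) * circle_mean (poly p) 1"
proof -
  obtain g h where gh: "balanced_factors (poly p) g h"
    using poly_balanced_factors by blast
  define G where "G = fps_expansion g 0"
  define H where "H = fps_expansion h 0"
  have hol: "g holomorphic_on ball 0 1" "h holomorphic_on ball 0 1"
    and cont: "continuous_on (cball 0 1) g" "continuous_on (cball 0 1) h"
    and prod: "\<And>z. z \<in> cball 0 1 \<Longrightarrow> poly p z = g z * h z"
    and eq: "\<And>z. z \<in> sphere 0 1 \<Longrightarrow> cmod (g z) = cmod (h z)"
    using gh unfolding balanced_factors_def by auto
  have exp: "g has_fps_expansion G" "h has_fps_expansion H"
    unfolding G_def H_def by (rule has_fps_expansion_fps_expansion[OF _ _ hol(1)], simp, simp)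
      (rule has_fps_expansion_fps_expansion[OF _ _ hol(2)], simp, simp)
  have sums: "z \<in> ball 0 1 \<Longrightarrow> (\<lambda>n. fps_nth G n * z ^ n) sums g z"
    "z \<in> ball 0 1 \<Longrightarrow> (\<lambda>n. fps_nth H n * z ^ n) sums h z" for z
    using has_fps_expansion_imp_sums_complex[OF exp(1), of 1 z]
      has_fps_expansion_imp_sums_complex[OF exp(2), of 1 z] hol
    by (auto simp: one_ereal_def)
  have "poly p has_fps_expansion fps_of_poly p"
    by (auto simp: has_fps_expansion_def)
  moreover have "poly p has_fps_expansion G * H"
  proof -
    have "eventually (\<lambda>z. z \<in> ball (0::complex) 1) (nhds 0)"
      by (intro eventually_nhds_in_open) auto
    hence "eventually (\<lambda>z. g z * h z = poly p z) (nhds 0)"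
      by eventually_elim (auto simp: prod)
    thus ?thesis
      using has_fps_expansion_mult[OF exp] by (simp add: has_fps_expansion_cong)
  qed
  ultimately have "fps_of_poly p = G * H" by (rule fps_expansion_unique_complex)
  hence coeff: "poly.coeff p n = (\<Sum>k\<le>n. fps_nth G k * fps_nth H (n - k))" for n
    by (metis fps_of_poly_nth fps_mult_nth atMost_atLeast0)
  define N where "N = circle_mean (poly p) 1"
  have sq: "cmod (poly p z) = cmod ((g z)\<^sup>2)" "cmod (poly p z) = cmod ((h z)\<^sup>2)"
    if "cmod z = 1" for z
    using prod[of z] eq[of z] that by (auto simp: norm_mult norm_power power2_eq_square)
  have Ng: "circle_mean (\<lambda>z. (g z)\<^sup>2) 1 = N" and Nh: "circle_mean (\<lambda>z. (h z)\<^sup>2) 1 = N"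
    unfolding N_def by (intro circle_mean_cong; use sq in simp)+
  have "(\<Sum>n\<le>M. cmod (poly.coeff p n * c n))
      \<le> (\<Sum>n\<le>M. \<Sum>k\<le>n. cmod (fps_nth G k) * cmod (fps_nth H (n - k)) * cmod (c n))"
    unfolding norm_mult coeff sum_distrib_right [symmetric]
    by (intro sum_mono mult_right_mono order.trans[OF norm_sum]) (auto simp: norm_mult)
  also have "\<dots> \<le> 2 * sqrt (6 * B) * sqrt (\<Sum>k\<le>M. (cmod (fps_nth G k))\<^sup>2)
      * sqrt (\<Sum>k\<le>M. (cmod (fps_nth H k))\<^sup>2)"
    by (rule hankel_bound) (use mean B in auto)
  also have "\<dots> \<le> 2 * sqrt (6 * B) * sqrt N * sqrt N"
    using bessel_unit_circle[OF sums(1) cont(1), of M] bessel_unit_circle[OF sums(2) cont(2), of M] B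
    by (intro mult_mono real_sqrt_le_mono) (auto simp: Ng Nh sum_nonneg circle_mean_nonneg N_def)
  also have "\<dots> = 2 * sqrt (6 * B) * N"
    using circle_mean_nonneg[of "poly p" 1] by (simp add: N_def)
  finally show ?thesis by (simp add: N_def)
qed

text \<open>Taylor polynomials of the dilation \<open>z \<mapsto> f (r * z)\<close> converge to it uniformly on the unit
  circle, hence in \<open>L\<^sup>1\<close>, which need not hold for the Taylor polynomials of \<open>f\<close> itself.\<close>
lemma dilated_multiplier_bound:
  fixes a c :: "nat \<Rightarrow> complex"
  assumes mean: "\<And>n. (\<Sum>k\<le>n. (real k + 1)\<^sup>2 * (cmod (c k))\<^sup>2) \<le> B * (real n + 1)"
    and B: "0 \<le> B"
    and sums: "\<And>z. z \<in> ball 0 1 \<Longrightarrow> (\<lambda>n. a n * z ^ n) sums f z"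
    and r: "0 \<le> r" "r < 1"
  shows "(\<Sum>n\<le>M. cmod (a n * c n) * r ^ n) \<le> 2 * sqrt (6 * B) * circle_mean f r"
proof -
  let ?P = "\<lambda>m z. \<Sum>k<m. a k * z ^ k"
  have "(\<lambda>m. circle_mean (?P m) r) \<longlonglongrightarrow> circle_mean f r"
    by (intro circle_mean_uniform_limit power_series_uniform_limit_sphere sums r)
       (auto intro!: continuous_intros)
  hence lim: "(\<lambda>m. 2 * sqrt (6 * B) * circle_mean (?P m) r) \<longlonglongrightarrow> 2 * sqrt (6 * B) * circle_mean f r"
    by (intro tendsto_intros)
  have "(\<Sum>n\<le>M. cmod (a n * c n) * r ^ n) \<le> 2 * sqrt (6 * B) * circle_mean (?P m) r"
    if m: "Suc M \<le> m" for m
  proof -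
    define p where "p = (\<Sum>k<m. monom (a k * of_real r ^ k) k)"
    have p: "poly.coeff p n = (if n < m then a n * of_real r ^ n else 0)" for n
      by (simp add: p_def coeff_sum if_distrib sum.delta cong: if_cong)
    have "poly p z = ?P m (of_real r * z)" for z
      by (simp add: p_def poly_sum poly_monom power_mult_distrib mult_ac)
    hence "circle_mean (poly p) 1 = circle_mean (?P m) r"
      by (simp add: circle_mean_def)
    moreover have "(\<Sum>n\<le>M. cmod (a n * c n) * r ^ n) = (\<Sum>n\<le>M. cmod (poly.coeff p n * c n))"
      using m r by (intro sum.cong) (auto simp: p norm_mult norm_power)
    ultimately show ?thesis using polynomial_multiplier_bound[OF mean B, where p = p and M = M] by simp
  qed
  thus ?thesis by (intro tendsto_lowerbound[OF lim] eventually_sequentiallyI) auto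
qed

theorem theorem3p1:
  shows "\<exists>A::real. \<forall>c\<in>X_space. \<forall>f\<in>Hardy1. \<forall>a::nat \<Rightarrow> complex.
    (\<forall>z\<in>ball 0 1. (\<lambda>n. a n * z ^ n) sums f z) \<longrightarrow>
      summable (\<lambda>n. cmod (a n * c n)) \<and>
      (\<Sum>n. cmod (a n * c n)) \<le> A * X_norm c * Hardy1_norm f"
proof (intro exI ballI allI impI)
  fix c f and a :: "nat \<Rightarrow> complex"
  assume c: "c \<in> X_space" and f: "f \<in> Hardy1"
    and sums: "\<forall>z\<in>ball 0 1. (\<lambda>n. a n * z ^ n) sums f z"
  define B where "B = (SUP n. X_mean c n)"
  have X_mean_le: "X_mean c n \<le> B" for n
    using c unfolding B_def X_space_def by (intro cSUP_upper) auto
  have mean: "(\<Sum>k\<le>n. (real k + 1)\<^sup>2 * (cmod (c k))\<^sup>2) \<le> B * (real n + 1)" for n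
    using X_mean_le[of n] by (simp add: X_mean_def field_simps)
  have B: "0 \<le> B" using X_mean_le[of 0] by (simp add: X_mean_def order.trans[rotated])
  define S where "S = 2 * sqrt 6 * X_norm c * Hardy1_norm f"
  have dilated: "(\<Sum>n\<le>M. cmod (a n * c n) * r ^ n) \<le> S" if "r \<in> {0<..<1}" for M r
  proof -
    have "(\<Sum>n\<le>M. cmod (a n * c n) * r ^ n) \<le> 2 * sqrt (6 * B) * circle_mean f r"
      by (rule dilated_multiplier_bound[OF mean B]) (use sums that in auto)
    also have "\<dots> \<le> 2 * sqrt (6 * B) * Hardy1_norm f"
      using f that B unfolding Hardy1_norm_def Hardy1_def
      by (intro mult_left_mono cSUP_upper) auto
    finally show ?thesis by (simp add: S_def X_norm_def B_def real_sqrt_mult mult_ac)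
  qed
  have partial: "(\<Sum>n\<le>M. cmod (a n * c n)) \<le> S" for M
  proof -
    have "((\<lambda>r. \<Sum>n\<le>M. cmod (a n * c n) * r ^ n)
        \<longlongrightarrow> (\<Sum>n\<le>M. cmod (a n * c n) * 1 ^ n)) (at_left (1::real))"
      by (intro tendsto_intros)
    moreover have "eventually (\<lambda>r. (\<Sum>n\<le>M. cmod (a n * c n) * r ^ n) \<le> S) (at_left (1::real))"
      using eventually_at_left_real[OF zero_less_one]
      by (rule eventually_mono) (auto intro!: dilated)
    ultimately have "(\<Sum>n\<le>M. cmod (a n * c n) * 1 ^ n) \<le> S"
      by (intro tendsto_upperbound) auto
    thus ?thesis by simp
  qed
  have partial': "(\<Sum>n<M. cmod (a n * c n)) \<le> S" for M
    by (rule order.trans[OF sum_mono2 partial[of M]]) auto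
  have summable: "summable (\<lambda>n. cmod (a n * c n))"
    by (rule summableI_nonneg_bounded[OF _ partial']) simp
  thus "summable (\<lambda>n. cmod (a n * c n)) \<and> (\<Sum>n. cmod (a n * c n)) \<le> (2 * sqrt 6) * X_norm c * Hardy1_norm f"
    using suminf_le_const[OF summable partial'] by (simp add: S_def)
qed

end
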